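(* For the six Apéry-like sequences of the second kind, named A, B, C, D, E, F, the values of $u_1$ and $N_{u_1}$ are as follows: A: $u_1=2$, $N_{u_1}=6$; B: $u_1=3$, $N_{u_1}=6$; C: $u_1=3$, $N_{u_1}=6$; D: $u_1=3$, $N_{u_1}=10$; E: $u_1=4$, $N_{u_1}=4$; F: $u_1=6$, $N_{u_1}=6$. In particular, the Apéry numbers $b_n=\sum_{k=0}^n\binom{n}{k}^2\binom{n+k}{k}$ (sequence D) satisfy $b_n\equiv 3^n\pmod{10}$ for all non-negative integers $n$.
   Context: The six Apéry-like sequences $\{u_n\}_{n\ge0}$ of the second kind are the integer sequences with $u_{-1}=0$, $u_0=1$ and $$(n+1)^2u_{n+1}-(An^2+An+\lambda)u_n+Bn^2u_{n-1}=0\quad(n\ge 0),$$ given, with their explicit formulas, by: A: $(A,B,\lambda)=(7,-8,2)$, $u_n=\sum_{k=0}^n\binom{n}{k}^3$; B: $(9,27,3)$, $u_n=\sum_{k=0}^n(-1)^k3^{n-3k}\binom{n}{3k}\binom{3k}{2k}\binom{2k}{k}$; C: $(10,9,3)$, $u_n=\sum_{k=0}^n\binom{n}{k}^2\binom{2k}{k}$; D: $(11,-1,3)$, $u_n=\sum_{k=0}^n\binom{n}{k}^2\binom{n+k}{k}$; E: $(12,32,4)$, $u_n=\sum_{k=0}^n4^{n-2k}\binom{n}{2k}\binom{2k}{k}^2$; F: $(17,72,6)$, $u_n=\sum_{k=0}^n(-1)^k8^{n-k}\binom{n}{k}\sum_{j=0}^k\binom{k}{j}^3$. For an integer $\alpha$,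 $N_\alpha$ denotes the largest positive integer such that $u_n\equiv\alpha^n\pmod{N_\alpha}$ for all non-negative integers $n$; $N_{u_1}$ is the case $\alpha=u_1$. *)

theory Defs
  imports "HOL-Number_Theory.Cong" Complex_Main
begin

section \<open>The six sequences\<close>

text \<open>
  All binomial coefficients are those on the naturals, so \<open>n choose j = 0\<close> for \<open>j > n\<close>.  In
  \<open>apery_B\<close> and \<open>apery_E\<close> the truncated exponents \<open>n - 3 * k\<close> and \<open>n - 2 * k\<close> are therefore
  harmless: whenever the subtraction truncates, the binomial coefficient next to it vanishes.
\<close>

definition apery_A :: "nat \<Rightarrow> int" where
  "apery_A n = (\<Sum>k=0..n. int (n choose k) ^ 3)"

definition apery_B :: "nat \<Rightarrow> int" where
  "apery_B n = (\<Sum>k=0..n. (-1) ^ k * 3 ^ (n - 3 * k) *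
     int (n choose (3 * k)) * int ((3 * k) choose (2 * k)) * int ((2 * k) choose k))"

definition apery_C :: "nat \<Rightarrow> int" where
  "apery_C n = (\<Sum>k=0..n. int (n choose k) ^ 2 * int ((2 * k) choose k))"

definition apery_D :: "nat \<Rightarrow> int" where
  "apery_D n = (\<Sum>k=0..n. int (n choose k) ^ 2 * int ((n + k) choose k))"

definition apery_E :: "nat \<Rightarrow> int" where
  "apery_E n = (\<Sum>k=0..n. 4 ^ (n - 2 * k) * int (n choose (2 * k)) * int ((2 * k) choose k) ^ 2)"

definition apery_F :: "nat \<Rightarrow> int" where
  "apery_F n = (\<Sum>k=0..n. (-1) ^ k * 8 ^ (n - k) * int (n choose k) *
     (\<Sum>j=0..k. int (k choose j) ^ 3))"


section \<open>The modulus $N_\alpha$\<close>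

text \<open>
  \<open>GREATEST\<close> is meaningful as soon as \<open>u n \<noteq> \<alpha> ^ n\<close> for some \<open>n\<close>, because the admissible moduli
  are then bounded; otherwise there is no largest modulus and the value is unspecified.
\<close>

definition congruence_modulus :: "(nat \<Rightarrow> int) \<Rightarrow> int \<Rightarrow> nat" where
  "congruence_modulus u \<alpha> =
     (GREATEST N. 0 < N \<and> (\<forall>n. [u n = \<alpha> ^ n] (mod int N)))"


section \<open>The defining recurrence\<close>

text \<open>
  The convention \<open>u\<^sub>-\<^sub>1 = 0\<close> is rendered by the conditional.  The recurrence determines \<open>u\<close>, so the
  lemmas below characterise the sequences given above by their explicit formulas.
\<close>

definition apery_like :: "int \<Rightarrow> int \<Rightarrow> int \<Rightarrow> (nat \<Rightarrow> int) \<Rightarrow> bool" where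
  "apery_like A B l u \<longleftrightarrow> u 0 = 1 \<and>
     (\<forall>n. (int n + 1)\<^sup>2 * u (n + 1) - (A * (int n)\<^sup>2 + A * int n + l) * u n
        + B * (int n)\<^sup>2 * (if n = 0 then 0 else u (n - 1)) = 0)"

lemma apery_like_unique:
  assumes u: "apery_like A B l u" and v: "apery_like A B l v"
  shows "u = v"
proof
  fix n show "u n = v n"
  proof (induction n rule: less_induct)
    case (less n)
    show ?case
    proof (cases n)
      case 0 then show ?thesis using u v by (simp add: apery_like_def)
    next
      case (Suc m)
      let ?p = "\<lambda>w :: nat \<Rightarrow> int. if m = 0 then 0 else w (m - 1)"
      have e: "(int m + 1)\<^sup>2 * w (m + 1)
          = (A * (int m)\<^sup>2 + A * int m + l) * w m - B * (int m)\<^sup>2 * ?p w"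
        if "apery_like A B l w" for w
        using that unfolding apery_like_def by (smt (verit))
      have "u m = v m" "?p u = ?p v" using less Suc by auto
      then have "(int m + 1)\<^sup>2 * u (m + 1) = (int m + 1)\<^sup>2 * v (m + 1)"
        using e[OF u] e[OF v] by simp
      moreover have "(int m + 1)\<^sup>2 \<noteq> 0" by (simp add: add_eq_0_iff)
      ultimately show ?thesis using Suc by simp
    qed
  qed
qed

lemma apery_likeI:
  assumes "u 0 = 1" "u 1 = l"
    and "\<And>m. (real m + 2)\<^sup>2 * of_int (u (m + 2))
        - (of_int A * (real m + 1)\<^sup>2 + of_int A * (real m + 1) + of_int l) * of_int (u (m + 1))
        + of_int B * (real m + 1)\<^sup>2 * of_int (u m) = 0"
  shows "apery_like A B l u"
  unfolding apery_like_def
proof (intro conjI allI)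
  fix n
  show "(int n + 1)\<^sup>2 * u (n + 1) - (A * (int n)\<^sup>2 + A * int n + l) * u n
        + B * (int n)\<^sup>2 * (if n = 0 then 0 else u (n - 1)) = 0"
  proof (cases n)
    case 0 then show ?thesis using assms by simp
  next
    case (Suc m)
    have "real_of_int ((int m + 2)\<^sup>2 * u (m + 2)
        - (A * (int m + 1)\<^sup>2 + A * (int m + 1) + l) * u (m + 1) + B * (int m + 1)\<^sup>2 * u m) = 0"
      using assms(3)[of m] by simp
    then have "(int m + 2)\<^sup>2 * u (m + 2)
        - (A * (int m + 1)\<^sup>2 + A * (int m + 1) + l) * u (m + 1) + B * (int m + 1)\<^sup>2 * u m = 0"
      by linarith
    then show ?thesis using Suc by (simp add: add.commute)
  qed
qed (use assms in auto)

text \<open>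
  Creative telescoping.  With \<open>M = n + 1\<close>, every summand of the recurrence is expressed through
  the summand of index \<open>k\<close> at \<open>M\<close>, and their combination is written as \<open>H (k + 1) - H k\<close>.
\<close>

lemma sum_telescoping_zero:
  fixes g H :: "nat \<Rightarrow> real"
  assumes "\<And>k. g k = H (Suc k) - H k" "H 0 = 0" "H (Suc M) = 0"
  shows "(\<Sum>k=0..M. g k) = 0"
proof -
  have "(\<Sum>k=0..M. g k) = (\<Sum>k<Suc M. H (Suc k) - H k)"
    by (simp add: assms(1) atLeast0AtMost lessThan_Suc_atMost)
  then show ?thesis using assms(2,3) by (simp add: sum_lessThan_telescope)
qed

lemma sum_extend:
  fixes f :: "nat \<Rightarrow> real"
  assumes "\<And>k. k > n \<Longrightarrow> f k = 0" "n \<le> M"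
  shows "sum f {0..n} = sum f {0..M}"
  using assms by (intro sum.mono_neutral_left) auto

lemma binomial_next: "(real k + 1) * real (n choose Suc k) = (real n - real k) * real (n choose k)"
proof (cases "k \<le> n")
  case True
  have "Suc k * (n choose Suc k) = (n - k) * (n choose k)"
    by (metis binomial_absorb_comp binomial_absorption)
  then have "real (Suc k) * real (n choose Suc k) = real (n - k) * real (n choose k)"
    by (metis of_nat_mult)
  then show ?thesis using True by (simp add: of_nat_diff add.commute)
qed (simp add: binomial_eq_0)

lemma binomial_down: "(real n + 1) * real (n choose k) = (real n + 1 - real k) * real (Suc n choose k)"
proof (cases "k \<le> Suc n")
  case True
  have "(Suc n - k) * (Suc n choose k) = Suc n * (n choose k)"
    using binomial_absorb_comp[of "Suc n" k] by simp
  then have "real (Suc n - k) * real (Suc n choose k) = real (Suc n) * real (n choose k)"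
    by (metis of_nat_mult)
  then show ?thesis using True by (simp add: of_nat_diff add.commute)
qed (simp add: binomial_eq_0)

lemma binomial_down2:
  "(real m + 2) * real (Suc m choose k) = (real m + 2 - real k) * real (Suc (Suc m) choose k)"
  "(real m + 2) * (real m + 1) * real (m choose k)
     = (real m + 2 - real k) * (real m + 1 - real k) * real (Suc (Suc m) choose k)"
proof -
  show 1: "(real m + 2) * real (Suc m choose k) = (real m + 2 - real k) * real (Suc (Suc m) choose k)"
    using binomial_down[of "Suc m" k] by (simp add: algebra_simps)
  have "(real m + 2) * (real m + 1) * real (m choose k)
     = (real m + 1 - real k) * ((real m + 2) * real (Suc m choose k))"
    using binomial_down[of m k] by algebra
  then show "(real m + 2) * (real m + 1) * real (m choose k)
     = (real m + 2 - real k) * (real m + 1 - real k) * real (Suc (Suc m) choose k)"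
    unfolding 1 by simp
qed


lemma recurrence_by_telescoping:
  fixes f0 f1 f2 H :: "nat \<Rightarrow> real"
  assumes "\<And>k. N * (c2 * f2 k - c1 * f1 k + c0 * f0 k) = H (Suc k) - H k"
    and "N \<noteq> 0" "H 0 = 0" "H (Suc (m + 2)) = 0"
    and "\<And>k. k > m + 1 \<Longrightarrow> f1 k = 0" "\<And>k. k > m \<Longrightarrow> f0 k = 0"
  shows "c2 * sum f2 {0..m + 2} - c1 * sum f1 {0..m + 1} + c0 * sum f0 {0..m} = 0"
proof -
  have e: "sum f1 {0..m + 1} = sum f1 {0..m + 2}" "sum f0 {0..m} = sum f0 {0..m + 2}"
    using assms(5,6) by (intro sum_extend; simp)+
  have "(\<Sum>k=0..m + 2. N * (c2 * f2 k - c1 * f1 k + c0 * f0 k)) = 0"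
    using assms(1,3,4) by (rule sum_telescoping_zero)
  then have "(\<Sum>k=0..m + 2. c2 * f2 k - c1 * f1 k + c0 * f0 k) = 0"
    using assms(2) by (simp add: sum_distrib_left[symmetric])
  then show ?thesis
    unfolding e by (simp only: sum.distrib sum_subtractf sum_distrib_left)
qed

lemma apery_like_A: "apery_like 7 (-8) 2 apery_A"
proof (rule apery_likeI)
  show "apery_A 0 = 1" "apery_A 1 = 2" by (simp_all add: apery_A_def)
  fix m
  define x y where "x = real m + 2" and "y = real m + 1"
  have xy: "y = x - 1" "x \<noteq> 0" "y \<noteq> 0" by (auto simp: x_def y_def)
  define Q where "Q = (\<lambda>k. 6*k^2 + 4*k^3 - 15*x*k - 30*x*k^2 - 8*x*k^3 + 10*x^2 + 57*x^2*k
     + 42*x^2*k^2 + 4*x^2*k^3 - 34*x^3 - 69*x^3*k - 18*x^3*k^2 + 38*x^4 + 27*x^4*k - 14*x^5)"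
  define H where "H = (\<lambda>k. real k ^ 3 * Q (real k) * real ((m + 2) choose k) ^ 3)"
  have "x\<^sup>2 * (\<Sum>k=0..m + 2. real ((m + 2) choose k) ^ 3)
      - (7 * y\<^sup>2 + 7 * y + 2) * (\<Sum>k=0..m + 1. real ((m + 1) choose k) ^ 3)
      + (-8 * y\<^sup>2) * (\<Sum>k=0..m. real (m choose k) ^ 3) = 0"
  proof (rule recurrence_by_telescoping[where N = "(x * y) ^ 3" and H = H])
    fix k
    define z where "z = real k"
    define b where "b = real ((m + 2) choose k)"
    define b1 where "b1 = real ((m + 1) choose k)"
    define b0 where "b0 = real (m choose k)"
    define c where "c = real ((m + 2) choose Suc k)"
    have 1: "x * b1 = (x - z) * b" and 2: "x * y * b0 = (x - z) * (y - z) * b"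
      using binomial_down2[of m k] by (simp_all add: x_def y_def z_def b_def b1_def b0_def)
    have 3: "(z + 1) * c = (x - z) * b"
      using binomial_next[of k "m + 2"] by (simp add: x_def z_def b_def c_def)
    have H1: "H (Suc k) = ((z + 1) * c) ^ 3 * Q (z + 1)"
      by (simp add: H_def z_def c_def power_mult_distrib add.commute mult.commute mult.left_commute)
    have "(x * y) ^ 3 * (x\<^sup>2 * b ^ 3 - (7 * y\<^sup>2 + 7 * y + 2) * b1 ^ 3 + (-8 * y\<^sup>2) * b0 ^ 3)
        = (x * y) ^ 3 * x\<^sup>2 * b ^ 3 - (7 * y\<^sup>2 + 7 * y + 2) * y ^ 3 * (x * b1) ^ 3
          - 8 * y\<^sup>2 * (x * y * b0) ^ 3"
      by (simp add: power_mult_distrib algebra_simps)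
    also have "\<dots> = ((x - z) * b) ^ 3 * Q (z + 1) - z ^ 3 * Q z * b ^ 3"
      unfolding 1 2 unfolding Q_def xy(1) by algebra
    also have "\<dots> = H (Suc k) - H k"
      unfolding H1 3 by (simp add: H_def z_def b_def)
    finally show "(x * y) ^ 3 * (x\<^sup>2 * real ((m + 2) choose k) ^ 3
        - (7 * y\<^sup>2 + 7 * y + 2) * real ((m + 1) choose k) ^ 3 + (-8 * y\<^sup>2) * real (m choose k) ^ 3)
        = H (Suc k) - H k"
      by (simp add: b_def b1_def b0_def)
  qed (use xy in \<open>simp_all add: H_def binomial_eq_0 del: binomial_Suc_Suc\<close>)
  then show "(real m + 2)\<^sup>2 * of_int (apery_A (m + 2))
        - (of_int 7 * (real m + 1)\<^sup>2 + of_int 7 * (real m + 1) + of_int 2) * of_int (apery_A (m + 1))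
        + of_int (-8) * (real m + 1)\<^sup>2 * of_int (apery_A m) = 0"
    by (simp add: apery_A_def x_def y_def)
qed

lemma central_binomial_next:
  "(real k + 1) * real ((2 * Suc k) choose Suc k) = 2 * (2 * real k + 1) * real ((2 * k) choose k)"
proof -
  have 1: "(real k + 1) * real ((2 * k + 1) choose k) = (2 * real k + 1) * real ((2 * k) choose k)"
    using binomial_down[of "2 * k" k] by simp
  have 2: "(real k + 1) * real ((2 * k + 1) choose Suc k) = (real k + 1) * real ((2 * k + 1) choose k)"
    using binomial_next[of k "2 * k + 1"] by (simp add: algebra_simps)
  have "real ((2 * Suc k) choose Suc k) = real ((2 * k + 1) choose k) + real ((2 * k + 1) choose Suc k)"
    by simp
  then show ?thesis using 1 2 by (simp add: algebra_simps)
qed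

lemma apery_like_C: "apery_like 10 9 3 apery_C"
proof (rule apery_likeI)
  show "apery_C 0 = 1" "apery_C 1 = 3" by (simp_all add: apery_C_def)
  fix m
  define x y where "x = real m + 2" and "y = real m + 1"
  have xy: "y = x - 1" "x \<noteq> 0" "y \<noteq> 0" by (auto simp: x_def y_def)
  define Q where "Q = (\<lambda>k. (3 * k - 4 * x) * (x - 1)\<^sup>2)"
  define H where "H = (\<lambda>k. real k ^ 3 * Q (real k) * real ((m + 2) choose k) ^ 2 * real ((2 * k) choose k))"
  have "x\<^sup>2 * (\<Sum>k=0..m + 2. real ((m + 2) choose k) ^ 2 * real ((2 * k) choose k))
      - (10 * y\<^sup>2 + 10 * y + 3) * (\<Sum>k=0..m + 1. real ((m + 1) choose k) ^ 2 * real ((2 * k) choose k))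
      + (9 * y\<^sup>2) * (\<Sum>k=0..m. real (m choose k) ^ 2 * real ((2 * k) choose k)) = 0"
  proof (rule recurrence_by_telescoping[where N = "(x * y) ^ 2" and H = H])
    fix k
    define z where "z = real k"
    define b where "b = real ((m + 2) choose k)"
    define b1 where "b1 = real ((m + 1) choose k)"
    define b0 where "b0 = real (m choose k)"
    define c where "c = real ((m + 2) choose Suc k)"
    define d where "d = real ((2 * k) choose k)"
    define e where "e = real ((2 * Suc k) choose Suc k)"
    have 1: "x * b1 = (x - z) * b" and 2: "x * y * b0 = (x - z) * (y - z) * b"
      using binomial_down2[of m k] by (simp_all add: x_def y_def z_def b_def b1_def b0_def)
    have 3: "(z + 1) * c = (x - z) * b"
      using binomial_next[of k "m + 2"] by (simp add: x_def z_def b_def c_def)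
    have 4: "(z + 1) * e = 2 * (2 * z + 1) * d"
      using central_binomial_next[of k] by (simp only: z_def d_def e_def)
    have "H (Suc k) = (z + 1) ^ 3 * Q (z + 1) * c ^ 2 * e"
      by (simp only: H_def z_def c_def e_def of_nat_Suc add.commute)
    also have "\<dots> = ((z + 1) * c) ^ 2 * ((z + 1) * e) * Q (z + 1)"
      by (simp add: power_mult_distrib power3_eq_cube power2_eq_square)
    finally have H1: "H (Suc k) = ((z + 1) * c) ^ 2 * ((z + 1) * e) * Q (z + 1)" .
    have "(x * y) ^ 2 * (x\<^sup>2 * (b ^ 2 * d) - (10 * y\<^sup>2 + 10 * y + 3) * (b1 ^ 2 * d) + (9 * y\<^sup>2) * (b0 ^ 2 * d))
        = (x * y) ^ 2 * x\<^sup>2 * b ^ 2 * d - (10 * y\<^sup>2 + 10 * y + 3) * y ^ 2 * (x * b1) ^ 2 * d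
          + 9 * y\<^sup>2 * (x * y * b0) ^ 2 * d"
      by (simp add: power_mult_distrib algebra_simps)
    also have "\<dots> = ((x - z) * b) ^ 2 * (2 * (2 * z + 1) * d) * Q (z + 1) - z ^ 3 * Q z * b ^ 2 * d"
      unfolding 1 2 unfolding Q_def xy(1) by algebra
    also have "\<dots> = H (Suc k) - H k"
      unfolding H1 3 4 by (simp add: H_def z_def b_def d_def)
    finally show "(x * y) ^ 2 * (x\<^sup>2 * (real ((m + 2) choose k) ^ 2 * real ((2 * k) choose k))
        - (10 * y\<^sup>2 + 10 * y + 3) * (real ((m + 1) choose k) ^ 2 * real ((2 * k) choose k))
        + (9 * y\<^sup>2) * (real (m choose k) ^ 2 * real ((2 * k) choose k)))
        = H (Suc k) - H k"
      by (simp only: b_def b1_def b0_def d_def)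
  qed (use xy in \<open>simp_all add: H_def binomial_eq_0 del: binomial_Suc_Suc\<close>)
  then show "(real m + 2)\<^sup>2 * of_int (apery_C (m + 2))
        - (of_int 10 * (real m + 1)\<^sup>2 + of_int 10 * (real m + 1) + of_int 3) * of_int (apery_C (m + 1))
        + of_int 9 * (real m + 1)\<^sup>2 * of_int (apery_C m) = 0"
    by (simp add: apery_C_def x_def y_def)
qed

lemma apery_like_D: "apery_like 11 (-1) 3 apery_D"
proof (rule apery_likeI)
  show "apery_D 0 = 1" "apery_D 1 = 3" by (simp_all add: apery_D_def)
  fix m
  define x y where "x = real m + 2" and "y = real m + 1"
  have xy: "y = x - 1" "x \<noteq> 0" "y \<noteq> 0" by (auto simp: x_def y_def)
  define Q where "Q = (\<lambda>k. - 5*x*k + x*k^2 + 7*x^2 + 16*x^2*k - 2*x^2*k^2 - 25*x^3 - 17*x^3*k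
     + x^3*k^2 + 29*x^4 + 6*x^4*k - 11*x^5)"
  define H where "H = (\<lambda>k. real k ^ 3 * Q (real k) * real ((m + 2) choose k) ^ 2 * real ((m + k) choose k))"
  have "x\<^sup>2 * (\<Sum>k=0..m + 2. real ((m + 2) choose k) ^ 2 * real ((m + 2 + k) choose k))
      - (11 * y\<^sup>2 + 11 * y + 3) * (\<Sum>k=0..m + 1. real ((m + 1) choose k) ^ 2 * real ((m + 1 + k) choose k))
      + (- (y\<^sup>2)) * (\<Sum>k=0..m. real (m choose k) ^ 2 * real ((m + k) choose k)) = 0"
  proof (rule recurrence_by_telescoping[where N = "(x * y) ^ 3" and H = H])
    fix k
    define z where "z = real k"
    define b where "b = real ((m + 2) choose k)"
    define b1 where "b1 = real ((m + 1) choose k)"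
    define b0 where "b0 = real (m choose k)"
    define c where "c = real ((m + 2) choose Suc k)"
    define d where "d = real ((m + k) choose k)"
    define d1 where "d1 = real ((m + 1 + k) choose k)"
    define d2 where "d2 = real ((m + 2 + k) choose k)"
    define e where "e = real ((m + Suc k) choose Suc k)"
    have 1: "x * b1 = (x - z) * b" and 2: "x * y * b0 = (x - z) * (y - z) * b"
      using binomial_down2[of m k] by (simp_all add: x_def y_def z_def b_def b1_def b0_def)
    have 3: "(z + 1) * c = (x - z) * b"
      using binomial_next[of k "m + 2"] by (simp add: x_def z_def b_def c_def)
    have 5: "y * d1 = (y + z) * d"
      using binomial_down[of "m + k" k] by (simp add: y_def z_def d1_def d_def algebra_simps)
    have "x * d2 = (x + z) * d1"
      using binomial_down[of "m + 1 + k" k] by (simp add: x_def z_def d2_def d1_def algebra_simps)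
    then have 6: "x * y * d2 = (x + z) * (y + z) * d"
      using 5 by algebra
    have 4: "(z + 1) * e = (y + z) * d"
      using 5 binomial_next[of k "m + 1 + k"] by (simp add: y_def z_def d1_def e_def algebra_simps)
    have "H (Suc k) = (z + 1) ^ 3 * Q (z + 1) * c ^ 2 * e"
      by (simp only: H_def z_def c_def e_def of_nat_Suc add.commute)
    also have "\<dots> = ((z + 1) * c) ^ 2 * ((z + 1) * e) * Q (z + 1)"
      by (simp add: power_mult_distrib power3_eq_cube power2_eq_square)
    finally have H1: "H (Suc k) = ((z + 1) * c) ^ 2 * ((z + 1) * e) * Q (z + 1)" .
    have "(x * y) ^ 3 * (x\<^sup>2 * (b ^ 2 * d2) - (11 * y\<^sup>2 + 11 * y + 3) * (b1 ^ 2 * d1) + (- (y\<^sup>2)) * (b0 ^ 2 * d))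
        = (x * y) ^ 2 * x\<^sup>2 * b ^ 2 * (x * y * d2)
          - (11 * y\<^sup>2 + 11 * y + 3) * x * y ^ 2 * (x * b1) ^ 2 * (y * d1)
          - y\<^sup>2 * x * y * (x * y * b0) ^ 2 * d"
      by (simp add: power_mult_distrib algebra_simps power3_eq_cube power2_eq_square)
    also have "\<dots> = ((x - z) * b) ^ 2 * ((y + z) * d) * Q (z + 1) - z ^ 3 * Q z * b ^ 2 * d"
      unfolding 1 2 5 6 unfolding Q_def xy(1) by algebra
    also have "\<dots> = H (Suc k) - H k"
      unfolding H1 3 4 by (simp add: H_def z_def b_def d_def)
    finally show "(x * y) ^ 3 * (x\<^sup>2 * (real ((m + 2) choose k) ^ 2 * real ((m + 2 + k) choose k))
        - (11 * y\<^sup>2 + 11 * y + 3) * (real ((m + 1) choose k) ^ 2 * real ((m + 1 + k) choose k))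
        + (- (y\<^sup>2)) * (real (m choose k) ^ 2 * real ((m + k) choose k)))
        = H (Suc k) - H k"
      by (simp only: b_def b1_def b0_def d_def d1_def d2_def)
  qed (use xy in \<open>simp_all add: H_def binomial_eq_0 del: binomial_Suc_Suc\<close>)
  then show "(real m + 2)\<^sup>2 * of_int (apery_D (m + 2))
        - (of_int 11 * (real m + 1)\<^sup>2 + of_int 11 * (real m + 1) + of_int 3) * of_int (apery_D (m + 1))
        + of_int (-1) * (real m + 1)\<^sup>2 * of_int (apery_D m) = 0"
    by (simp add: apery_D_def x_def y_def)
qed

lemma apery_E_real:
  "real_of_int (apery_E n) = (\<Sum>k=0..n. 4 ^ n * real (n choose (2 * k)) * (real ((2 * k) choose k) ^ 2 / 16 ^ k))"
  unfolding apery_E_def of_int_sum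
proof (rule sum.cong)
  fix k
  have "(4::real) ^ (n - 2 * k) = 4 ^ n / 16 ^ k" if "2 * k \<le> n"
    using that by (simp add: power_diff power_mult)
  then show "real_of_int (4 ^ (n - 2 * k) * int (n choose (2 * k)) * int ((2 * k) choose k) ^ 2)
      = 4 ^ n * real (n choose (2 * k)) * (real ((2 * k) choose k) ^ 2 / 16 ^ k)"
    by (cases "2 * k \<le> n") (simp_all add: binomial_eq_0)
qed simp

lemma apery_like_E: "apery_like 12 32 4 apery_E"
proof (rule apery_likeI)
  show "apery_E 0 = 1" "apery_E 1 = 4" by (simp_all add: apery_E_def)
  fix m
  define x y where "x = real m + 2" and "y = real m + 1"
  have xy: "y = x - 1" "x \<noteq> 0" "y \<noteq> 0" by (auto simp: x_def y_def)
  define P where "P = (4::real) ^ m"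
  define w where "w = (\<lambda>k. real ((2 * k) choose k) ^ 2 / 16 ^ k)"
  define H where "H = (\<lambda>k. 128 * (1 - x) * P * real k ^ 3 * real ((m + 2) choose (2 * k)) * w k)"
  have "x\<^sup>2 * (\<Sum>k=0..m + 2. 16 * P * real ((m + 2) choose (2 * k)) * w k)
      - (12 * y\<^sup>2 + 12 * y + 4) * (\<Sum>k=0..m + 1. 4 * P * real ((m + 1) choose (2 * k)) * w k)
      + (32 * y\<^sup>2) * (\<Sum>k=0..m. P * real (m choose (2 * k)) * w k) = 0"
  proof (rule recurrence_by_telescoping[where N = "x * y" and H = H])
    fix k
    define z where "z = real k"
    define b where "b = real ((m + 2) choose (2 * k))"
    define b1 where "b1 = real ((m + 1) choose (2 * k))"
    define b0 where "b0 = real (m choose (2 * k))"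
    define c where "c = real ((m + 2) choose (2 * Suc k))"
    define v where "v = w k"
    define v' where "v' = w (Suc k)"
    have 1: "x * b1 = (x - 2 * z) * b" and 2: "x * y * b0 = (x - 2 * z) * (y - 2 * z) * b"
      using binomial_down2[of m "2 * k"] by (simp_all add: x_def y_def z_def b_def b1_def b0_def)
    define c1 where "c1 = real ((m + 2) choose (Suc (2 * k)))"
    have "(2 * z + 1) * c1 = (x - 2 * z) * b"
      using binomial_next[of "2 * k" "m + 2"] by (simp only: x_def z_def b_def c1_def) simp
    moreover have "(2 * z + 2) * c = (x - 2 * z - 1) * c1"
      using binomial_next[of "2 * k + 1" "m + 2"] unfolding x_def z_def c_def c1_def
      by (simp add: algebra_simps del: binomial_Suc_Suc)
    ultimately have 3: "(2 * z + 1) * (2 * z + 2) * c = (x - 2 * z) * (x - 2 * z - 1) * b"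
      by algebra
    have "(z + 1) ^ 2 * real ((2 * Suc k) choose Suc k) ^ 2 = (2 * (2 * z + 1)) ^ 2 * real ((2 * k) choose k) ^ 2"
      using central_binomial_next[of k] unfolding z_def by (metis power_mult_distrib)
    then have "(z + 1) ^ 2 * real ((2 * Suc k) choose Suc k) ^ 2 = 4 * (2 * z + 1) ^ 2 * real ((2 * k) choose k) ^ 2"
      by (simp only: power_mult_distrib) simp
    then have 4: "4 * (z + 1) ^ 2 * v' = (2 * z + 1) ^ 2 * v"
      unfolding v_def v'_def w_def power_Suc by (simp del: binomial_Suc_Suc mult_Suc_right)
    have H1: "H (Suc k) = 128 * (1 - x) * P * (z + 1) ^ 3 * c * v'"
      by (simp only: H_def z_def c_def v'_def of_nat_Suc add.commute)
    have 5: "8 * (z + 1) ^ 3 * c * v' = (x - 2 * z) * (x - 2 * z - 1) * (2 * z + 1) * b * v"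
    proof -
      have "8 * (z + 1) ^ 3 * c * v' = 2 * (z + 1) * c * (4 * (z + 1) ^ 2 * v')" by algebra
      also have "\<dots> = ((2 * z + 1) * (2 * z + 2) * c) * (2 * z + 1) * v" unfolding 4 by algebra
      finally show ?thesis unfolding 3 by (simp add: mult_ac)
    qed
    have "x * y * (x\<^sup>2 * (16 * P * b * v) - (12 * y\<^sup>2 + 12 * y + 4) * (4 * P * b1 * v) + (32 * y\<^sup>2) * (P * b0 * v))
        = 16 * x ^ 3 * y * P * b * v - 4 * (12 * y\<^sup>2 + 12 * y + 4) * y * P * (x * b1) * v
          + 32 * y\<^sup>2 * P * (x * y * b0) * v"
      by algebra
    also have "\<dots> = 16 * (1 - x) * P * ((x - 2 * z) * (x - 2 * z - 1) * (2 * z + 1) * b * v)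
        - 128 * (1 - x) * P * z ^ 3 * b * v"
      unfolding 1 2 unfolding xy(1) by algebra
    also have "\<dots> = H (Suc k) - H k"
      unfolding H1 5[symmetric] by (simp add: H_def z_def b_def v_def)
    finally show "x * y * (x\<^sup>2 * (16 * P * real ((m + 2) choose (2 * k)) * w k)
        - (12 * y\<^sup>2 + 12 * y + 4) * (4 * P * real ((m + 1) choose (2 * k)) * w k)
        + (32 * y\<^sup>2) * (P * real (m choose (2 * k)) * w k)) = H (Suc k) - H k"
      by (simp only: b_def b1_def b0_def v_def)
  qed (use xy in \<open>simp_all add: H_def binomial_eq_0 del: binomial_Suc_Suc\<close>)
  then show "(real m + 2)\<^sup>2 * of_int (apery_E (m + 2))
        - (of_int 12 * (real m + 1)\<^sup>2 + of_int 12 * (real m + 1) + of_int 4) * of_int (apery_E (m + 1))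
        + of_int 32 * (real m + 1)\<^sup>2 * of_int (apery_E m) = 0"
    by (simp add: apery_E_real x_def y_def P_def w_def
        del: sum.atLeast0_atMost_Suc sum.cl_ivl_Suc binomial_Suc_Suc)
qed

lemma trinomial_next:
  "(real k + 1) ^ 3 * (real ((3 * Suc k) choose (2 * Suc k)) * real ((2 * Suc k) choose Suc k))
   = (3 * real k + 1) * (3 * real k + 2) * (3 * real k + 3) *
     (real ((3 * k) choose (2 * k)) * real ((2 * k) choose k))"
proof -
  have t: "real ((3 * j) choose (2 * j)) * real ((2 * j) choose j) = fact (3 * j) / fact j ^ 3" for j
    by (simp add: binomial_fact power3_eq_cube)
  have "fact (3 * Suc k) = (3 * real k + 1) * (3 * real k + 2) * (3 * real k + 3) * fact (3 * k)"
  proof -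
    have "3 * Suc k = Suc (Suc (Suc (3 * k)))" by simp
    then show ?thesis by (simp only: fact_Suc) (simp add: mult_ac add.commute)
  qed
  moreover have "fact (Suc k) ^ 3 = (real k + 1) ^ 3 * fact k ^ 3"
    by (simp add: power_mult_distrib add.commute)
  ultimately show ?thesis
    unfolding t by (simp add: add_eq_0_iff)
qed

lemma apery_B_real:
  "real_of_int (apery_B n) = (\<Sum>k=0..n. 3 ^ n * real (n choose (3 * k)) *
     (real ((3 * k) choose (2 * k)) * real ((2 * k) choose k) * (- 1 / 27) ^ k))"
  unfolding apery_B_def of_int_sum
proof (rule sum.cong)
  fix k
  have "(- 1) ^ k * (3::real) ^ (n - 3 * k) = 3 ^ n * (- 1 / 27) ^ k" if "3 * k \<le> n"
    using that by (simp only: power_diff power_mult power_divide) (simp add: power_diff power_mult)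
  then show "real_of_int ((-1) ^ k * 3 ^ (n - 3 * k) *
     int (n choose (3 * k)) * int ((3 * k) choose (2 * k)) * int ((2 * k) choose k))
      = 3 ^ n * real (n choose (3 * k)) *
     (real ((3 * k) choose (2 * k)) * real ((2 * k) choose k) * (- 1 / 27) ^ k)"
    by (cases "3 * k \<le> n") (simp_all add: binomial_eq_0)
qed simp

lemma apery_like_B: "apery_like 9 27 3 apery_B"
proof (rule apery_likeI)
  show "apery_B 0 = 1" "apery_B 1 = 3" by (simp_all add: apery_B_def)
  fix m
  define x y where "x = real m + 2" and "y = real m + 1"
  have xy: "y = x - 1" "x \<noteq> 0" "y \<noteq> 0" by (auto simp: x_def y_def)
  define P where "P = (3::real) ^ m"
  define w where "w = (\<lambda>k. real ((3 * k) choose (2 * k)) * real ((2 * k) choose k) * (- 1 / 27) ^ k)"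
  define H where "H = (\<lambda>k. 243 * (1 - x) * P * real k ^ 3 * real ((m + 2) choose (3 * k)) * w k)"
  have "x\<^sup>2 * (\<Sum>k=0..m + 2. 9 * P * real ((m + 2) choose (3 * k)) * w k)
      - (9 * y\<^sup>2 + 9 * y + 3) * (\<Sum>k=0..m + 1. 3 * P * real ((m + 1) choose (3 * k)) * w k)
      + (27 * y\<^sup>2) * (\<Sum>k=0..m. P * real (m choose (3 * k)) * w k) = 0"
  proof (rule recurrence_by_telescoping[where N = "x * y" and H = H])
    fix k
    define z where "z = real k"
    define b where "b = real ((m + 2) choose (3 * k))"
    define b1 where "b1 = real ((m + 1) choose (3 * k))"
    define b0 where "b0 = real (m choose (3 * k))"
    define c where "c = real ((m + 2) choose (3 * Suc k))"
    define v where "v = w k"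
    define v' where "v' = w (Suc k)"
    have 1: "x * b1 = (x - 3 * z) * b" and 2: "x * y * b0 = (x - 3 * z) * (y - 3 * z) * b"
      using binomial_down2[of m "3 * k"] by (simp_all add: x_def y_def z_def b_def b1_def b0_def)
    define c1 where "c1 = real ((m + 2) choose (Suc (3 * k)))"
    define c2 where "c2 = real ((m + 2) choose (Suc (Suc (3 * k))))"
    have "(3 * z + 1) * c1 = (x - 3 * z) * b"
      using binomial_next[of "3 * k" "m + 2"] by (simp only: x_def z_def b_def c1_def) simp
    moreover have "(3 * z + 2) * c2 = (x - 3 * z - 1) * c1"
      using binomial_next[of "3 * k + 1" "m + 2"] unfolding x_def z_def c2_def c1_def
      by (simp add: algebra_simps del: binomial_Suc_Suc)
    moreover have s3: "3 * Suc k = Suc (Suc (Suc (3 * k)))" by simp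
    have "(3 * z + 3) * c = (x - 3 * z - 2) * c2"
      using binomial_next[of "3 * k + 2" "m + 2"] unfolding x_def z_def c_def c2_def s3
      by (simp add: algebra_simps del: binomial_Suc_Suc)
    ultimately have 3: "(3 * z + 1) * (3 * z + 2) * (3 * z + 3) * c
        = (x - 3 * z) * (x - 3 * z - 1) * (x - 3 * z - 2) * b"
      by algebra
    define q where "q = (- 1 / 27 :: real) ^ k"
    define r where "r = real ((3 * k) choose (2 * k)) * real ((2 * k) choose k)"
    define r' where "r' = real ((3 * Suc k) choose (2 * Suc k)) * real ((2 * Suc k) choose Suc k)"
    have r: "(z + 1) ^ 3 * r' = (3 * z + 1) * (3 * z + 2) * (3 * z + 3) * r"
      using trinomial_next[of k] by (simp only: z_def r_def r'_def)
    have v: "v = r * q" "v' = r' * (- 1 / 27 * q)"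
      by (simp_all only: v_def v'_def w_def r_def r'_def q_def power_Suc)
    have H1: "H (Suc k) = 243 * (1 - x) * P * (z + 1) ^ 3 * c * v'"
      by (simp only: H_def z_def c_def v'_def of_nat_Suc add.commute)
    have H0: "H k = 243 * (1 - x) * P * z ^ 3 * b * v"
      by (simp only: H_def z_def b_def v_def)
    have "27 * (z + 1) ^ 3 * c * v' = - (((z + 1) ^ 3 * r') * c * q)"
      unfolding v by simp
    also have "\<dots> = - (((3 * z + 1) * (3 * z + 2) * (3 * z + 3) * c) * r * q)"
      unfolding r by (simp add: mult_ac)
    also have "\<dots> = - ((x - 3 * z) * (x - 3 * z - 1) * (x - 3 * z - 2) * b * v)"
      unfolding 3 v by (simp add: mult_ac)
    finally have 5: "(x - 3 * z) * (x - 3 * z - 1) * (x - 3 * z - 2) * b * v = - (27 * (z + 1) ^ 3 * c * v')"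
      by simp
    have "x * y * (x\<^sup>2 * (9 * P * b * v) - (9 * y\<^sup>2 + 9 * y + 3) * (3 * P * b1 * v) + (27 * y\<^sup>2) * (P * b0 * v))
        = 9 * x ^ 3 * y * P * b * v - 3 * (9 * y\<^sup>2 + 9 * y + 3) * y * P * (x * b1) * v
          + 27 * y\<^sup>2 * P * (x * y * b0) * v"
      by algebra
    also have "\<dots> = - 9 * (1 - x) * P * ((x - 3 * z) * (x - 3 * z - 1) * (x - 3 * z - 2) * b * v)
        - 243 * (1 - x) * P * z ^ 3 * b * v"
      unfolding 1 2 unfolding xy(1) by algebra
    also have "\<dots> = H (Suc k) - H k"
      unfolding H0 H1 5 by algebra
    finally show "x * y * (x\<^sup>2 * (9 * P * real ((m + 2) choose (3 * k)) * w k)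
        - (9 * y\<^sup>2 + 9 * y + 3) * (3 * P * real ((m + 1) choose (3 * k)) * w k)
        + (27 * y\<^sup>2) * (P * real (m choose (3 * k)) * w k)) = H (Suc k) - H k"
      by (simp only: b_def b1_def b0_def v_def)
  qed (use xy in \<open>simp_all add: H_def binomial_eq_0 del: binomial_Suc_Suc\<close>)
  then show "(real m + 2)\<^sup>2 * of_int (apery_B (m + 2))
        - (of_int 9 * (real m + 1)\<^sup>2 + of_int 9 * (real m + 1) + of_int 3) * of_int (apery_B (m + 1))
        + of_int 27 * (real m + 1)\<^sup>2 * of_int (apery_B m) = 0"
    by (simp add: apery_B_real x_def y_def P_def w_def
        del: sum.atLeast0_atMost_Suc sum.cl_ivl_Suc binomial_Suc_Suc)
qed

lemma apery_F_real:
  "real_of_int (apery_F n) = (\<Sum>k=0..n. 8 ^ n * real (n choose k) * ((- 1 / 8) ^ k * real_of_int (apery_A k)))"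
  unfolding apery_F_def of_int_sum apery_A_def[symmetric]
proof (rule sum.cong)
  fix k assume "k \<in> {0..n}"
  then have "(- 1) ^ k * (8::real) ^ (n - k) = 8 ^ n * (- 1 / 8) ^ k"
    by (simp only: power_divide) (simp add: power_diff)
  then show "real_of_int ((-1) ^ k * 8 ^ (n - k) * int (n choose k) * apery_A k)
      = 8 ^ n * real (n choose k) * ((- 1 / 8) ^ k * real_of_int (apery_A k))"
    by simp
qed simp

lemma apery_like_F: "apery_like 17 72 6 apery_F"
proof (rule apery_likeI)
  show "apery_F 0 = 1" "apery_F 1 = 6" by (simp_all add: apery_F_def)
  fix m
  define x y where "x = real m + 2" and "y = real m + 1"
  have xy: "y = x - 1" "x \<noteq> 0" "y \<noteq> 0" by (auto simp: x_def y_def)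
  define P where "P = (8::real) ^ m"
  define w where "w = (\<lambda>k. (- 1 / 8) ^ k * real_of_int (apery_A k))"
  define H where "H = (\<lambda>k. 64 * (x - 1) * P * real k ^ 2 * real ((m + 2) choose k) * (- 1 / 8) ^ k *
      ((x - real k) * (if k = 0 then 0 else real_of_int (apery_A (k - 1))) - real k * real_of_int (apery_A k)))"
  have "x\<^sup>2 * (\<Sum>k=0..m + 2. 64 * P * real ((m + 2) choose k) * w k)
      - (17 * y\<^sup>2 + 17 * y + 6) * (\<Sum>k=0..m + 1. 8 * P * real ((m + 1) choose k) * w k)
      + (72 * y\<^sup>2) * (\<Sum>k=0..m. P * real (m choose k) * w k) = 0"
  proof (rule recurrence_by_telescoping[where N = "x * y" and H = H])
    fix k
    define z where "z = real k"
    define b where "b = real ((m + 2) choose k)"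
    define b1 where "b1 = real ((m + 1) choose k)"
    define b0 where "b0 = real (m choose k)"
    define c where "c = real ((m + 2) choose Suc k)"
    define q where "q = (- 1 / 8 :: real) ^ k"
    define f where "f = real_of_int (apery_A k)"
    define f' where "f' = real_of_int (apery_A (Suc k))"
    define e where "e = (if k = 0 then 0 else real_of_int (apery_A (k - 1)))"
    have 1: "x * b1 = (x - z) * b" and 2: "x * y * b0 = (x - z) * (y - z) * b"
      using binomial_down2[of m k] by (simp_all add: x_def y_def z_def b_def b1_def b0_def)
    have 3: "(z + 1) * c = (x - z) * b"
      using binomial_next[of k "m + 2"] by (simp add: x_def z_def b_def c_def)
    have "real_of_int ((int k + 1)\<^sup>2 * apery_A (k + 1) - (7 * (int k)\<^sup>2 + 7 * int k + 2) * apery_A k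
        + (- 8) * (int k)\<^sup>2 * (if k = 0 then 0 else apery_A (k - 1))) = 0"
      using apery_like_A unfolding apery_like_def by (metis of_int_0)
    then have 4: "(z + 1)\<^sup>2 * f' = (7 * z\<^sup>2 + 7 * z + 2) * f + 8 * z\<^sup>2 * e"
      by (simp add: z_def f_def f'_def e_def split: if_splits)
    have "H (Suc k) = 64 * (x - 1) * P * (z + 1) ^ 2 * c * (- 1 / 8 * q) * ((x - (z + 1)) * f - (z + 1) * f')"
      by (simp add: H_def z_def c_def q_def f_def f'_def add.commute del: binomial_Suc_Suc)
    also have "\<dots> = - 8 * (x - 1) * P * ((z + 1) * c) * q * ((z + 1) * (x - z - 1) * f - (z + 1)\<^sup>2 * f')"
      by algebra
    finally have H1: "H (Suc k) = - 8 * (x - 1) * P * ((z + 1) * c) * q * ((z + 1) * (x - z - 1) * f - (z + 1)\<^sup>2 * f')" .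
    have H0: "H k = 64 * (x - 1) * P * z ^ 2 * b * q * ((x - z) * e - z * f)"
      by (simp only: H_def z_def b_def q_def f_def e_def)
    have "x * y * (x\<^sup>2 * (64 * P * b * (q * f)) - (17 * y\<^sup>2 + 17 * y + 6) * (8 * P * b1 * (q * f))
          + (72 * y\<^sup>2) * (P * b0 * (q * f)))
        = 64 * x ^ 3 * y * P * b * q * f - 8 * (17 * y\<^sup>2 + 17 * y + 6) * y * P * (x * b1) * q * f
          + 72 * y\<^sup>2 * P * (x * y * b0) * q * f"
      by algebra
    also have "\<dots> = H (Suc k) - H k"
      unfolding H0 H1 1 2 3 4 unfolding xy(1) by algebra
    finally show "x * y * (x\<^sup>2 * (64 * P * real ((m + 2) choose k) * w k)
        - (17 * y\<^sup>2 + 17 * y + 6) * (8 * P * real ((m + 1) choose k) * w k)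
        + (72 * y\<^sup>2) * (P * real (m choose k) * w k)) = H (Suc k) - H k"
      by (simp only: b_def b1_def b0_def w_def q_def f_def)
  qed (use xy in \<open>simp_all add: H_def binomial_eq_0 del: binomial_Suc_Suc\<close>)
  then show "(real m + 2)\<^sup>2 * of_int (apery_F (m + 2))
        - (of_int 17 * (real m + 1)\<^sup>2 + of_int 17 * (real m + 1) + of_int 6) * of_int (apery_F (m + 1))
        + of_int 72 * (real m + 1)\<^sup>2 * of_int (apery_F m) = 0"
    by (simp add: apery_F_real x_def y_def P_def w_def
        del: sum.atLeast0_atMost_Suc sum.cl_ivl_Suc binomial_Suc_Suc)
qed

end

theory Submission
  imports Defs
begin

text \<open>
  Each modulus is attained as the difference \<open>u j - u 1 ^ j\<close> for \<open>j = 2\<close> (\<open>j = 3\<close> for sequence B),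
  so no larger modulus is possible, and what has to be shown is the congruence itself.

  Four sequences need only their explicit formulas.  For A, \<open>x\<^sup>3 \<equiv> x (mod 6)\<close> turns the sum of the
  cubed binomial coefficients into \<open>2 ^ n\<close>; F is a binomial transform of A, so \<open>2 ^ k\<close> may be put for
  the inner sum and the binomial theorem gives \<open>(8 - 2) ^ n\<close>.  For B and E every
  term with \<open>k > 0\<close> vanishes modulo 6 and 4, because the central binomial coefficients are even and
  \<open>(3k choose 2k)\<close> is a multiple of 3.

  For C and D the same parity argument settles the modulus 2, and there remain the primes \<open>p = 3\<close>
  and \<open>p = 5\<close>.  Modulo \<open>p\<close> one has \<open>u (p m) \<equiv> u m\<close>: only the terms with \<open>p dvd k\<close> survive, and
  \<open>(p m choose p k) \<equiv> (m choose k)\<close> (\<open>prime_multiples_choose_cong\<close>).  Starting from \<open>u (p m)\<close>, the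
  recurrence, whose leading coefficient \<open>(n + 1)\<^sup>2\<close> is a unit modulo \<open>p\<close> until the next multiple of
  \<open>p\<close>, forces \<open>u (p m + r) \<equiv> 3 ^ r u (p m)\<close> for \<open>r < p\<close>.  Fermat's congruence \<open>3 ^ p \<equiv> 3\<close> makes the
  powers of 3 obey the same two rules, and induction along the base-\<open>p\<close> digits of \<open>n\<close> concludes
  (\<open>power_cong_from_blocks\<close>).
\<close>

section \<open>Determining the modulus\<close>

lemma congruence_modulus_eqI:
  assumes cong: "\<And>n. [u n = \<alpha> ^ n] (mod int N)"
    and attained: "\<bar>u j - \<alpha> ^ j\<bar> = int N" and "N > 0"
  shows "congruence_modulus u \<alpha> = N"
  unfolding congruence_modulus_def
proof (rule Greatest_equality)
  fix M assume "0 < M \<and> (\<forall>n. [u n = \<alpha> ^ n] (mod int M))"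
  then have "int M dvd \<bar>u j - \<alpha> ^ j\<bar>" by (simp add: cong_iff_dvd_diff)
  then show "M \<le> N" unfolding attained using \<open>N > 0\<close> by (simp add: dvd_imp_le)
qed (use assms in auto)

lemma cong_first_term:
  fixes f :: "nat \<Rightarrow> int"
  assumes "\<And>k. k > 0 \<Longrightarrow> m dvd f k"
  shows "[(\<Sum>k=0..n. f k) = f 0] (mod m)"
proof -
  have "m dvd (\<Sum>k=Suc 0..n. f k)" using assms by (intro dvd_sum) auto
  then show ?thesis
    by (simp add: sum.atLeast_Suc_atMost cong_iff_dvd_diff)
qed

lemma even_central_binomial:
  assumes "k > 0" shows "even ((2 * k) choose k)"
proof -
  obtain j where j: "k = Suc j" using assms gr0_implies_Suc by blast
  have "Suc (2 * j) choose Suc j = Suc (2 * j) choose j"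
    using binomial_symmetric[of j "Suc (2 * j)"] by simp
  then have "(2 * k) choose k = 2 * (Suc (2 * j) choose j)"
    unfolding j by (simp del: binomial_Suc_Suc add: binomial_Suc_Suc[of "Suc (2 * j)"])
  then show ?thesis by simp
qed

section \<open>The sequences A, F, B and E\<close>

lemma cong_cube_6: "[x ^ 3 = x] (mod 6)" for x :: int
proof -
  have "x mod 6 = 0 \<or> x mod 6 = 1 \<or> x mod 6 = 2 \<or> x mod 6 = 3 \<or> x mod 6 = 4 \<or> x mod 6 = 5"
    by presburger
  then have "(x mod 6) ^ 3 mod 6 = x mod 6" by (elim disjE) simp_all
  then show ?thesis by (simp add: cong_def power_mod)
qed

lemma apery_A_cong: "[apery_A n = 2 ^ n] (mod 6)"
proof -
  have "[apery_A n = (\<Sum>k=0..n. int (n choose k))] (mod 6)"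
    unfolding apery_A_def by (intro cong_sum cong_cube_6)
  also have "(\<Sum>k=0..n. int (n choose k)) = int (2 ^ n)"
    unfolding choose_row_sum[symmetric] by (simp add: atLeast0AtMost)
  finally show ?thesis by simp
qed

lemma apery_F_cong: "[apery_F n = 6 ^ n] (mod 6)"
proof -
  have "[apery_F n = (\<Sum>k=0..n. (-1) ^ k * 8 ^ (n - k) * int (n choose k) * 2 ^ k)] (mod 6)"
    unfolding apery_F_def apery_A_def[symmetric] by (intro cong_sum cong_mult cong_refl apery_A_cong)
  also have "(\<Sum>k=0..n. (-1) ^ k * 8 ^ (n - k) * int (n choose k) * 2 ^ k) = (- 2 + 8) ^ n"
    unfolding binomial_ring atLeast0AtMost
    by (intro sum.cong refl) (simp add: power_minus[of "2::int"])
  finally show ?thesis by simp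
qed

lemma three_dvd_choose:
  assumes "k > 0" shows "3 dvd ((3 * k) choose (2 * k))"
proof -
  obtain j where j: "k = Suc j" using assms gr0_implies_Suc by blast
  have "(3 * k) choose (2 * k) = (3 * k) choose k"
    using binomial_symmetric[of "2 * k" "3 * k"] by simp
  moreover have "k * ((3 * k) choose k) = k * (3 * ((3 * k - 1) choose j))"
    using binomial_absorption[of j "3 * k"] unfolding j by (simp del: binomial_Suc_Suc mult_Suc mult_Suc_right)
  ultimately show ?thesis using assms by simp
qed

lemma apery_B_cong: "[apery_B n = 3 ^ n] (mod 6)"
proof -
  have "[apery_B n = (-1) ^ 0 * 3 ^ (n - 3 * 0) * int (n choose (3 * 0)) *
      int ((3 * 0) choose (2 * 0)) * int ((2 * 0) choose 0)] (mod 6)"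
    unfolding apery_B_def
  proof (rule cong_first_term)
    fix k :: nat assume "k > 0"
    then have "int (3 * 2) dvd int (((3 * k) choose (2 * k)) * ((2 * k) choose k))"
      unfolding int_dvd_int_iff by (intro mult_dvd_mono three_dvd_choose even_central_binomial)
    then show "6 dvd (-1) ^ k * 3 ^ (n - 3 * k) * int (n choose (3 * k)) *
        int ((3 * k) choose (2 * k)) * int ((2 * k) choose k)"
      by (simp add: mult.assoc dvd_mult)
  qed
  then show ?thesis by simp
qed

lemma apery_E_cong: "[apery_E n = 4 ^ n] (mod 4)"
proof -
  have "[apery_E n = 4 ^ (n - 2 * 0) * int (n choose (2 * 0)) * int ((2 * 0) choose 0) ^ 2] (mod 4)"
    unfolding apery_E_def
  proof (rule cong_first_term)
    fix k :: nat assume "k > 0"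
    then have "(2::int) ^ 2 dvd int ((2 * k) choose k) ^ 2"
      by (intro dvd_power_same) (simp add: even_central_binomial)
    then show "4 dvd 4 ^ (n - 2 * k) * int (n choose (2 * k)) * int ((2 * k) choose k) ^ 2"
      by (simp add: dvd_mult)
  qed
  then show ?thesis by simp
qed

section \<open>Binomial coefficients modulo a prime\<close>

lemma prime_dvd_multiple_choose:
  fixes p :: nat
  assumes "prime p" "\<not> p dvd k"
  shows "p dvd ((p * m) choose k)"
proof -
  obtain j where j: "k = Suc j" using assms(2) by (cases k) auto
  have "k * ((p * m) choose k) = p * m * ((p * m - 1) choose j)"
    using binomial_absorption[of j "p * m"] unfolding j .
  then have "p dvd k * ((p * m) choose k)" by (simp add: mult.assoc)
  then show ?thesis using assms by (simp add: prime_dvd_mult_iff)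
qed

text \<open>
  The case of Lucas' theorem in which the last digits are zero.  In Vandermonde's sum for
  \<open>p + p m\<close> the factor \<open>p choose i\<close> kills all terms but \<open>i = 0\<close> and \<open>i = p\<close>, and these two
  reproduce Pascal's rule for \<open>m\<close>.
\<close>

lemma prime_multiples_choose_cong:
  fixes p :: nat
  assumes p: "prime p"
  shows "[(p * m) choose (p * k) = m choose k] (mod p)"
proof (induction m arbitrary: k)
  case 0
  show ?case using p by (cases "k = 0") (simp_all add: binomial_eq_0 prime_gt_0_nat)
next
  case (Suc m)
  show ?case
  proof (cases k)
    case 0 then show ?thesis by simp
  next
    case (Suc j)
    let ?f = "\<lambda>i. (p choose i) * ((p * m) choose (p * k - i))"
    have pos: "p > 0" using p by (rule prime_gt_0_nat)
    have "p dvd (p choose i)" if "i \<noteq> 0" "i \<noteq> p" for i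
      using that dvd_choose_prime[of i p] p by (cases "i < p") (auto simp: binomial_eq_0)
    then have rest: "p dvd (\<Sum>i\<in>{..p * k} - {0, p}. ?f i)"
      by (intro dvd_sum dvd_mult2) auto
    have "{0, p} \<subseteq> {..p * k}" by (auto simp: Suc)
    then have "(\<Sum>i\<le>p * k. ?f i) = (\<Sum>i\<in>{..p * k} - {0, p}. ?f i) + (\<Sum>i\<in>{0, p}. ?f i)"
      by (intro sum.subset_diff) auto
    moreover have "p * k - p = p * j" by (simp add: Suc)
    ultimately have "(\<Sum>i\<le>p * k. ?f i) = (\<Sum>i\<in>{..p * k} - {0, p}. ?f i)
        + (((p * m) choose (p * k)) + ((p * m) choose (p * j)))"
      using pos by simp
    moreover have "(\<Sum>i\<le>p * k. ?f i) = (p * Suc m) choose (p * k)"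
      using vandermonde[of p "p * m" "p * k"] by simp
    ultimately have "[(p * Suc m) choose (p * k)
        = 0 + (((p * m) choose (p * k)) + ((p * m) choose (p * j)))] (mod p)"
      using cong_add[OF rest[folded cong_0_iff] cong_refl] by simp
    then have "[(p * Suc m) choose (p * k)
        = ((p * m) choose (p * k)) + ((p * m) choose (p * j))] (mod p)"
      by simp
    moreover have "[((p * m) choose (p * k)) + ((p * m) choose (p * j))
        = (m choose k) + (m choose j)] (mod p)"
      by (rule cong_add[OF Suc.IH Suc.IH])
    ultimately have "[(p * Suc m) choose (p * k) = (m choose k) + (m choose j)] (mod p)"
      by (rule cong_trans)
    then show ?thesis by (simp only: Suc binomial_Suc_Suc add.commute)
  qed
qed

text \<open>
  The common shape of sequences C and D: the binomial square kills all terms whose index is prime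
  to \<open>p\<close>, and the cofactor \<open>g\<close> has to be compatible with multiplying the arguments by \<open>p\<close>.
\<close>

lemma binomial_square_sum_cong:
  fixes p :: nat and g :: "nat \<Rightarrow> nat \<Rightarrow> int"
  assumes p: "prime p" and g: "\<And>k. [g (p * m) (p * k) = g m k] (mod int p)"
  shows "[(\<Sum>k=0..p * m. int ((p * m) choose k) ^ 2 * g (p * m) k)
        = (\<Sum>k=0..m. int (m choose k) ^ 2 * g m k)] (mod int p)"
proof -
  let ?f = "\<lambda>k. int ((p * m) choose k) ^ 2 * g (p * m) k"
  have pos: "p > 0" using p by (rule prime_gt_0_nat)
  have sub: "(*) p ` {0..m} \<subseteq> {0..p * m}" by auto
  have "int p dvd ?f k" if k: "k \<in> {0..p * m} - (*) p ` {0..m}" for k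
  proof -
    have "\<not> p dvd k" using k pos by (auto simp: dvd_def)
    then have "p dvd ((p * m) choose k)" by (rule prime_dvd_multiple_choose[OF p])
    then show ?thesis by (simp add: power2_eq_square)
  qed
  then have "int p dvd (\<Sum>k\<in>{0..p * m} - (*) p ` {0..m}. ?f k)"
    by (rule dvd_sum)
  moreover have "(\<Sum>k=0..p * m. ?f k)
      = (\<Sum>k\<in>{0..p * m} - (*) p ` {0..m}. ?f k) + (\<Sum>k\<in>(*) p ` {0..m}. ?f k)"
    using sub by (intro sum.subset_diff) auto
  moreover have "(\<Sum>k\<in>(*) p ` {0..m}. ?f k) = (\<Sum>k=0..m. ?f (p * k))"
    using pos by (intro sum.reindex_cong[where l = "(*) p"]) (auto simp: inj_on_def)
  ultimately have "[(\<Sum>k=0..p * m. ?f k) = (\<Sum>k=0..m. ?f (p * k))] (mod int p)"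
    by (simp add: cong_iff_dvd_diff)
  moreover have "[(\<Sum>k=0..m. ?f (p * k)) = (\<Sum>k=0..m. int (m choose k) ^ 2 * g m k)] (mod int p)"
    using prime_multiples_choose_cong[OF p] g
    by (intro cong_sum cong_mult cong_pow) (simp_all add: cong_int_iff)
  ultimately show ?thesis by (rule cong_trans)
qed

lemma apery_C_prime_multiple:
  assumes "prime p" shows "[apery_C (p * m) = apery_C m] (mod int p)"
  unfolding apery_C_def
proof (rule binomial_square_sum_cong[OF assms, where g = "\<lambda>_ k. int ((2 * k) choose k)"])
  fix k
  have "2 * (p * k) = p * (2 * k)" by simp
  then show "[int ((2 * (p * k)) choose (p * k)) = int ((2 * k) choose k)] (mod int p)"
    using prime_multiples_choose_cong[OF assms, of "2 * k" k] by (simp only: cong_int_iff)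
qed

lemma apery_D_prime_multiple:
  assumes "prime p" shows "[apery_D (p * m) = apery_D m] (mod int p)"
  unfolding apery_D_def
proof (rule binomial_square_sum_cong[OF assms, where g = "\<lambda>n k. int ((n + k) choose k)"])
  fix k
  show "[int ((p * m + p * k) choose (p * k)) = int ((m + k) choose k)] (mod int p)"
    using prime_multiples_choose_cong[OF assms, of "m + k" k] by (simp only: cong_int_iff distrib_left)
qed

section \<open>The recurrence modulo a prime\<close>

lemma power_cong_from_blocks:
  fixes u :: "nat \<Rightarrow> int" and a :: int
  assumes "p > 1" "u 0 = 1"
    and mult: "\<And>m. [u (p * m) = u m] (mod int p)"
    and block: "\<And>m r. r < p \<Longrightarrow> [u (p * m + r) = a ^ r * u (p * m)] (mod int p)"
    and fermat: "[a ^ p = a] (mod int p)"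
  shows "[u n = a ^ n] (mod int p)"
proof (induction n rule: less_induct)
  case (less n)
  show ?case
  proof (cases "n = 0")
    case True then show ?thesis using assms(2) by simp
  next
    case False
    define m r where "m = n div p" and "r = n mod p"
    have n: "n = p * m + r" and "r < p" "m < n"
      using False \<open>p > 1\<close> by (simp_all add: m_def r_def)
    have "[u n = a ^ r * u (p * m)] (mod int p)"
      unfolding n by (rule block[OF \<open>r < p\<close>])
    also have "[a ^ r * u (p * m) = a ^ r * a ^ m] (mod int p)"
      by (intro cong_mult cong_refl cong_trans[OF mult] less.IH[OF \<open>m < n\<close>])
    also have "[a ^ r * a ^ m = a ^ r * (a ^ p) ^ m] (mod int p)"
      by (intro cong_mult cong_refl cong_pow cong_sym[OF fermat])
    also have "a ^ r * (a ^ p) ^ m = a ^ n"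
      by (simp add: n power_add power_mult)
    finally show ?thesis .
  qed
qed

text \<open>In the recurrence modulo \<open>p\<close> the coefficients depend only on the residue \<open>c\<close> of the index.\<close>

lemma apery_like_cong:
  assumes u: "apery_like A B l u" and c: "[int n = c] (mod p)"
  shows "[(c + 1)\<^sup>2 * u (n + 1) = (A * c\<^sup>2 + A * c + l) * u n
     - B * c\<^sup>2 * (if n = 0 then 0 else u (n - 1))] (mod p)"
proof -
  let ?v = "if n = 0 then 0 else u (n - 1)"
  let ?R = "\<lambda>c. (A * c\<^sup>2 + A * c + l) * u n - B * c\<^sup>2 * ?v"
  have "(int n + 1)\<^sup>2 * u (n + 1) = ?R (int n)"
    using u unfolding apery_like_def by (smt (verit))
  moreover have "[(c + 1)\<^sup>2 * u (n + 1) = (int n + 1)\<^sup>2 * u (n + 1)] (mod p)"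
    by (intro cong_mult cong_add cong_pow cong_refl cong_sym[OF c])
  moreover have "[?R (int n) = ?R c] (mod p)"
    by (intro cong_mult cong_add cong_diff cong_pow cong_refl c)
  ultimately show ?thesis by (simp only:) (rule cong_trans)
qed

lemma apery_C_cong_3: "[apery_C n = 3 ^ n] (mod 3)"
proof -
  note rec = apery_like_cong[OF apery_like_C, where p = 3]
  have "[apery_C n = 3 ^ n] (mod int 3)"
  proof (rule power_cong_from_blocks)
    fix m r :: nat assume "r < 3"
    have index: "[int (3 * m + c) = int c] (mod 3)" for c by (simp add: cong_def)
    have "[apery_C (3 * m + 1) = 3 * apery_C (3 * m)] (mod 3)"
      using rec[OF index[of 0]] by simp
    then have 1: "3 dvd apery_C (3 * m + 1)" by (simp add: cong_dvd_iff)
    have "[4 * apery_C (3 * m + 2) = 23 * apery_C (3 * m + 1) - 9 * apery_C (3 * m)] (mod 3)"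
      using rec[OF index[of 1]] by simp
    then obtain c where "23 * apery_C (3 * m + 1) - 9 * apery_C (3 * m) = 4 * apery_C (3 * m + 2) + 3 * c"
      by (auto simp: cong_iff_lin)
    moreover obtain a where "apery_C (3 * m + 1) = 3 * a" using 1 by (rule dvdE)
    ultimately have "apery_C (3 * m + 2) = 3 * (23 * a - 3 * apery_C (3 * m) - c - apery_C (3 * m + 2))"
      by simp
    then have "3 dvd apery_C (3 * m + 2)" by (rule dvdI)
    moreover have "r = 0 \<or> r = 1 \<or> r = 2" using \<open>r < 3\<close> by auto
    ultimately show "[apery_C (3 * m + r) = 3 ^ r * apery_C (3 * m)] (mod int 3)"
      using 1 by (auto simp: cong_iff_dvd_diff intro: dvd_diff)
  qed (use apery_C_prime_multiple[of 3] in \<open>simp_all add: apery_C_def cong_def\<close>)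
  then show ?thesis by simp
qed

lemma apery_D_cong_5: "[apery_D n = 3 ^ n] (mod 5)"
proof -
  note rec = apery_like_cong[OF apery_like_D, where p = 5]
  \<comment> \<open>From \<open>u (5 m)\<close> the recurrence produces its multiples by \<open>3, 9, 27, 81\<close>.  The leading coefficients
     4, 9 and 16 are congruent to \<open>-1\<close>, \<open>-1\<close> and 1, so they can be inverted; the
     multiples of 5 below record this division explicitly.\<close>
  have "[apery_D n = 3 ^ n] (mod int 5)"
  proof (rule power_cong_from_blocks)
    fix m r :: nat assume "r < 5"
    let ?u = "\<lambda>r. apery_D (5 * m + r)"
    have index: "[int (5 * m + c) = int c] (mod 5)" for c by (simp add: cong_def)
    have 1: "[?u 1 = 3 * ?u 0] (mod 5)"
      using rec[OF index[of 0]] by simp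
    have "[4 * ?u 2 = 25 * ?u 1 + ?u 0] (mod 5)"
      using rec[OF index[of 1]] by simp
    then obtain c2 where "25 * ?u 1 + ?u 0 = 4 * ?u 2 + 5 * c2" by (auto simp: cong_iff_lin)
    then have 2: "9 * ?u 0 = ?u 2 + 5 * (2 * ?u 0 + 5 * ?u 1 - c2 - ?u 2)" by simp
    have "[9 * ?u 3 = 69 * ?u 2 + 4 * ?u 1] (mod 5)"
      using rec[OF index[of 2]] by (simp add: numeral_3_eq_3)
    then obtain c3 where "69 * ?u 2 + 4 * ?u 1 = 9 * ?u 3 + 5 * c3" by (auto simp: cong_iff_lin)
    moreover obtain a where "3 * ?u 0 = ?u 1 + 5 * a" using 1 by (auto simp: cong_iff_lin)
    moreover obtain b where b: "9 * ?u 0 = ?u 2 + 5 * b" by (rule that, rule 2)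
    ultimately have 3: "27 * ?u 0 = ?u 3 + 5 * (132 * ?u 0 - 69 * b - 4 * a - c3 - 2 * ?u 3)" by simp
    have "[16 * ?u 4 = 135 * ?u 3 + 9 * ?u 2] (mod 5)"
      using rec[OF index[of 3]] by (simp add: add.commute)
    then obtain c4 where "135 * ?u 3 + 9 * ?u 2 = 16 * ?u 4 + 5 * c4" by (auto simp: cong_iff_lin)
    with b have 4: "81 * ?u 0 = ?u 4 + 5 * (3 * ?u 4 - 27 * ?u 3 + 9 * b + c4)" by simp
    have blocks: "[?u 2 = 9 * ?u 0] (mod 5)" "[?u 3 = 27 * ?u 0] (mod 5)" "[?u 4 = 81 * ?u 0] (mod 5)"
      unfolding cong_iff_lin by (rule exI, rule 2, rule exI, rule 3, rule exI, rule 4)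
    have "r = 0 \<or> r = 1 \<or> r = 2 \<or> r = 3 \<or> r = 4" using \<open>r < 5\<close> by auto
    then show "[?u r = 3 ^ r * apery_D (5 * m)] (mod int 5)"
      using 1 blocks by auto
  qed (use apery_D_prime_multiple[of 5] in \<open>simp_all add: apery_D_def cong_def\<close>)
  then show ?thesis by simp
qed

section \<open>The sequences C and D\<close>

lemma cong_pow_3_2: "[3 ^ n = 1] (mod 2 :: int)"
proof -
  have "[3 = 1] (mod 2 :: int)" by (simp add: cong_def)
  then have "[3 ^ n = 1 ^ n] (mod 2 :: int)" by (rule cong_pow)
  then show ?thesis by (simp only: power_one)
qed

lemma apery_C_cong: "[apery_C n = 3 ^ n] (mod 6)"
proof -
  have "[apery_C n = int (n choose 0) ^ 2 * int ((2 * 0) choose 0)] (mod 2)"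
    unfolding apery_C_def
    by (rule cong_first_term) (simp add: even_central_binomial)
  then have "[apery_C n = 3 ^ n] (mod 2)"
    using cong_pow_3_2[of n] by (simp add: cong_def)
  then have "[apery_C n = 3 ^ n] (mod 2 * 3)"
    by (intro coprime_cong_mult apery_C_cong_3) auto
  then show ?thesis by simp
qed

lemma even_choose_mult_choose:
  assumes "k > 0" shows "even ((n choose k) * ((n + k) choose k))"
proof (cases "k \<le> n")
  case True
  \<comment> \<open>Both sides count pairs of disjoint \<open>k\<close>-subsets of an \<open>(n + k)\<close>-element set.\<close>
  have "((n + k) choose (2 * k)) * ((2 * k) choose k) = ((n + k) choose k) * (n choose k)"
    using choose_mult[of k "2 * k" "n + k"] True by simp
  then show ?thesis using even_central_binomial[OF assms] by (metis dvd_mult mult.commute)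
qed (simp add: binomial_eq_0)

lemma apery_D_cong: "[apery_D n = 3 ^ n] (mod 10)"
proof -
  have "[apery_D n = int (n choose 0) ^ 2 * int ((n + 0) choose 0)] (mod 2)"
    unfolding apery_D_def
  proof (rule cong_first_term)
    fix k :: nat assume "k > 0"
    then show "2 dvd int (n choose k) ^ 2 * int ((n + k) choose k)"
      using even_choose_mult_choose[of k n] by auto
  qed
  then have "[apery_D n = 3 ^ n] (mod 2)"
    using cong_pow_3_2[of n] by (simp add: cong_def)
  then have "[apery_D n = 3 ^ n] (mod 2 * 5)"
    by (intro coprime_cong_mult apery_D_cong_5) auto
  then show ?thesis by simp
qed

section \<open>The six moduli\<close>

theorem mainTheorem3:
  shows "(apery_A 1 = 2 \<and> congruence_modulus apery_A (apery_A 1) = 6)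
       \<and> (apery_B 1 = 3 \<and> congruence_modulus apery_B (apery_B 1) = 6)
       \<and> (apery_C 1 = 3 \<and> congruence_modulus apery_C (apery_C 1) = 6)
       \<and> (apery_D 1 = 3 \<and> congruence_modulus apery_D (apery_D 1) = 10)
       \<and> (apery_E 1 = 4 \<and> congruence_modulus apery_E (apery_E 1) = 4)
       \<and> (apery_F 1 = 6 \<and> congruence_modulus apery_F (apery_F 1) = 6)
       \<and> (\<forall>n. [apery_D n = 3 ^ n] (mod 10))"
proof -
  have u1: "apery_A 1 = 2" "apery_B 1 = 3" "apery_C 1 = 3" "apery_D 1 = 3" "apery_E 1 = 4"
      "apery_F 1 = 6"
    by (simp_all add: apery_A_def apery_B_def apery_C_def apery_D_def apery_E_def apery_F_def)
  have attained: "apery_A 2 = 10" "apery_B 3 = 21" "apery_C 2 = 15" "apery_D 2 = 19" "apery_E 2 = 20"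
      "apery_F 2 = 42"
    by (simp_all add: apery_A_def apery_B_def apery_C_def apery_D_def apery_E_def apery_F_def
        numeral_eq_Suc)
  have "congruence_modulus apery_A 2 = 6"
    by (rule congruence_modulus_eqI[where j = 2]) (simp_all add: apery_A_cong attained)
  moreover have "congruence_modulus apery_B 3 = 6"
    by (rule congruence_modulus_eqI[where j = 3]) (simp_all add: apery_B_cong attained)
  moreover have "congruence_modulus apery_C 3 = 6"
    by (rule congruence_modulus_eqI[where j = 2]) (simp_all add: apery_C_cong attained)
  moreover have "congruence_modulus apery_D 3 = 10"
    by (rule congruence_modulus_eqI[where j = 2]) (simp_all add: apery_D_cong attained)
  moreover have "congruence_modulus apery_E 4 = 4"
    by (rule congruence_modulus_eqI[where j = 2]) (simp_all add: apery_E_cong attained)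
  moreover have "congruence_modulus apery_F 6 = 6"
    by (rule congruence_modulus_eqI[where j = 2]) (simp_all add: apery_F_cong attained)
  ultimately show ?thesis using u1 apery_D_cong by simp
qed

end
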